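(* Let $(X_n,M_n)_{n\ge0}$ be the $\{-1,1\}\times\mathbb{N}^*$-valued Markov chain described in the context, with $(X_0,M_0)=(1,1)$, and let $S_n=\sum_{k=0}^nX_k$. Let $0<\rho<\lambda<1$ and let $\tau$ be a random variable independent of $(X_n,M_n)_{n\ge0}$ with $\mathbb{P}(\tau=k)=\rho^k(1-\rho)$, $k\ge0$. Then $$\mathbb{E}[\lambda^{S_\tau}]=\frac{(\rho-1)\left\{\lambda\rho\left(\widehat{\mathcal{P}}_1\left(\frac{\rho}{\lambda}\right)+\widehat{\mathcal{P}}_2(\lambda\rho)\right)+(\lambda\rho-1)\widehat{\mathcal{P}}_1\left(\frac{\rho}{\lambda}\right)\widehat{\mathcal{P}}_2(\lambda\rho)\right\}}{\rho(\lambda\rho-1)\widehat{\mathcal{P}}_2(\lambda\rho)+\lambda\rho(\rho-\lambda)\widehat{\mathcal{P}}_1\left(\frac{\rho}{\lambda}\right)+(\lambda\rho-1)(\rho-\lambda)\widehat{\mathcal{P}}_1\left(\frac{\rho}{\lambda}\right)\widehat{\mathcal{P}}_2(\lambda\rho)},$$ where $\widehat{\mathcal{P}}_i(x)=\sum_{k\ge1}\mathcal{P}_i(k)x^k$ for $0<x<1$, $i=1,2$.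
   Context: $\mathbb{N}^*=\{1,2,\ldots\}$; $a_1=-1$, $a_2=1$; $\alpha_{i,n}\in(0,1)$ for $i=1,2$, $n\ge1$. The chain $(X_n,M_n)$ goes from $(a_i,n)$ to $(a_i,n+1)$ with probability $1-\alpha_{i,n}$ and to $(a_j,1)$, $j\ne i$, with probability $\alpha_{i,n}$. $\mathcal{P}_i(m)=\prod_{k=1}^{m-1}(1-\alpha_{i,k})$ for $m\ge1$ (empty product $=1$). *)

theory Defs
  imports "HOL-Probability.Probability"
begin

text \<open>A time-homogeneous Markov chain with state space \<open>S\<close> (discrete) and transition
  probabilities \<open>p z z'\<close>. The \<open>Z n\<close> are \<open>S\<close>-valued on all of \<open>space \<Omega>\<close>, because they are measurable
  into \<open>count_space S\<close>.\<close>

definition markov_chain ::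
    "'w measure \<Rightarrow> 's set \<Rightarrow> ('s \<Rightarrow> 's \<Rightarrow> real) \<Rightarrow> (nat \<Rightarrow> 'w \<Rightarrow> 's) \<Rightarrow> bool" where
  "markov_chain \<Omega> S p Z \<longleftrightarrow>
     prob_space \<Omega> \<and>
     (\<forall>n. Z n \<in> measurable \<Omega> (count_space S)) \<and>
     (\<forall>n z. \<forall>z'\<in>S. \<P>(\<omega> in \<Omega>. \<forall>k\<le>n. Z k \<omega> = z k) > 0 \<longrightarrow>
        \<P>(\<omega> in \<Omega>. Z (Suc n) \<omega> = z' \<bar> \<forall>k\<le>n. Z k \<omega> = z k) = p (z n) z')"

text \<open>Independence of two random elements with values in possibly different types; the library's
  \<open>indep_var\<close> requires both to have the same value type.\<close>

definition indep_rv ::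
    "'w measure \<Rightarrow> 'b measure \<Rightarrow> ('w \<Rightarrow> 'b) \<Rightarrow> 'c measure \<Rightarrow> ('w \<Rightarrow> 'c) \<Rightarrow> bool" where
  "indep_rv \<Omega> A X B Y \<longleftrightarrow>
     X \<in> measurable \<Omega> A \<and> Y \<in> measurable \<Omega> B \<and>
     prob_space.indep_set \<Omega> (sets (vimage_algebra (space \<Omega>) X A))
                            (sets (vimage_algebra (space \<Omega>) Y B))"

definition state_space :: "(int \<times> nat) set" where
  "state_space = {-1, 1} \<times> {1..}"

text \<open>The index \<open>i\<close> with \<open>a\<^sub>i = x\<close>, where \<open>a\<^sub>1 = -1\<close> and \<open>a\<^sub>2 = 1\<close>.\<close>

definition letter_index :: "int \<Rightarrow> nat" where
  "letter_index x = (if x = -1 then 1 else 2)"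

text \<open>On \<open>{-1, 1}\<close>, \<open>- x\<close> is the letter different from \<open>x\<close>.\<close>

definition trans_prob :: "(nat \<Rightarrow> nat \<Rightarrow> real) \<Rightarrow> int \<times> nat \<Rightarrow> int \<times> nat \<Rightarrow> real" where
  "trans_prob \<alpha> = (\<lambda>(x, n) (y, m).
     if y = x \<and> m = n + 1 then 1 - \<alpha> (letter_index x) n
     else if y = - x \<and> m = 1 then \<alpha> (letter_index x) n
     else 0)"

definition cal_P :: "(nat \<Rightarrow> nat \<Rightarrow> real) \<Rightarrow> nat \<Rightarrow> nat \<Rightarrow> real" where
  "cal_P \<alpha> i m = (\<Prod>k\<in>{1..<m}. 1 - \<alpha> i k)"

text \<open>The sum over \<open>k \<ge> 1\<close>, reindexed by \<open>k = Suc j\<close>.\<close>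

definition hat_P :: "(nat \<Rightarrow> nat \<Rightarrow> real) \<Rightarrow> nat \<Rightarrow> real \<Rightarrow> real" where
  "hat_P \<alpha> i x = (\<Sum>j. cal_P \<alpha> i (Suc j) * x ^ Suc j)"

definition walk :: "(nat \<Rightarrow> 'w \<Rightarrow> int) \<Rightarrow> nat \<Rightarrow> 'w \<Rightarrow> int" where
  "walk X n \<omega> = (\<Sum>k=0..n. X k \<omega>)"

end

theory Submission
  imports Defs
begin

text \<open>Weight the event that the chain sits in the state \<open>(x, n)\<close> at time \<open>k\<close> by \<open>l powi S\<^sub>k\<close>, and let
\<open>G x n\<close> be the generating function in \<open>\<rho>\<close> of these weights over all times \<open>k\<close>. One step of the
chain multiplies the weight by \<open>l powi\<close> the new letter, so \<open>G\<close> satisfies the forward equation of the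
chain with \<open>\<rho> * l powi x\<close> attached to every step that lands on the letter \<open>x\<close>. Write
\<open>y x = \<rho> * l powi x\<close>.

Within a run the only way to reach age \<open>n + 1\<close> is to survive age \<open>n\<close>, hence \<open>G x\<close> is the value at the
start of a run times the survival probability and a power of \<open>y x\<close> (\<open>state_gf_run\<close>). Summing over
ages produces exactly the series \<open>hat_P\<close> at \<open>y x\<close>; summing with the switching probabilities gives an
Abel transform of it, since the probability of switching at age \<open>n\<close> is a difference of two consecutive
survival probabilities (\<open>hat_P_sums\<close>). A run starts at time \<open>0\<close> or by a switch
(\<open>state_gf_switch\<close>), so the two unknowns \<open>G 1\<close> and \<open>G (-1)\<close> at the start of a run satisfy a linear
system, and solving it gives the formula (\<open>switching_system_solution\<close>). Independence of \<open>\<tau>\<close>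
turns the expectation into \<open>1 - \<rho>\<close> times the total of \<open>G\<close> (\<open>nn_integral_independent_time\<close>).

All sums are first taken in the extended nonnegative reals, where they may be interchanged freely.
The bound \<open>-(k + 1) \<le> S\<^sub>k\<close> together with \<open>\<rho> < l < 1\<close> makes the total finite, and this finiteness is
what allows the linear system to be read, and solved, over the reals.\<close>

section \<open>Sums over countable values, the Markov property and independence\<close>

lemma suminf_swap: "(\<Sum>m. \<Sum>n. f m n) = (\<Sum>n. \<Sum>m. f m n)" for f :: "nat \<Rightarrow> nat \<Rightarrow> ennreal"
  using nn_integral_suminf[of "\<lambda>n m. f m n" "count_space UNIV"]
  by (simp add: nn_integral_count_space_nat)

lemma nn_integral_split_countable:
  assumes T: "T \<in> measurable \<Omega> (count_space I)" and I: "countable I"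
    and f [measurable]: "f \<in> borel_measurable \<Omega>"
  shows "(\<integral>\<^sup>+\<omega>. f \<omega> \<partial>\<Omega>)
    = (\<integral>\<^sup>+i. (\<integral>\<^sup>+\<omega>. f \<omega> * indicator {\<omega>. T \<omega> = i} \<omega> \<partial>\<Omega>) \<partial>count_space I)"
proof -
  have ev: "{\<omega> \<in> space \<Omega>. T \<omega> = i} \<in> sets \<Omega>" if "i \<in> I" for i
    using measurable_sets[OF T, of "{i}"] that by (simp add: vimage_def Int_def conj_commute)
  have meas: "(\<lambda>\<omega>. f \<omega> * indicator {\<omega>. T \<omega> = i} \<omega>) \<in> borel_measurable \<Omega>" if "i \<in> I" for i
    using ev[OF that] by (intro borel_measurable_times_ennreal f borel_measurable_indicator')
      (auto simp: Int_def vimage_def)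
  have "(\<integral>\<^sup>+i. f \<omega> * indicator {\<omega>. T \<omega> = i} \<omega> \<partial>count_space I) = f \<omega>"
    if "\<omega> \<in> space \<Omega>" for \<omega>
  proof -
    have "(\<integral>\<^sup>+i. f \<omega> * indicator {\<omega>. T \<omega> = i} \<omega> \<partial>count_space I)
        = (\<integral>\<^sup>+i. f \<omega> * indicator {T \<omega>} i \<partial>count_space I)"
      by (intro nn_integral_cong) (auto split: split_indicator)
    then show ?thesis
      using measurable_space[OF T that] by (simp add: nn_integral_cmult_indicator)
  qed
  then have "(\<integral>\<^sup>+\<omega>. f \<omega> \<partial>\<Omega>)
    = (\<integral>\<^sup>+\<omega>. (\<integral>\<^sup>+i. f \<omega> * indicator {\<omega>. T \<omega> = i} \<omega> \<partial>count_space I) \<partial>\<Omega>)"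
    by (intro nn_integral_cong) simp
  also have "\<dots> = (\<integral>\<^sup>+i. (\<integral>\<^sup>+\<omega>. f \<omega> * indicator {\<omega>. T \<omega> = i} \<omega> \<partial>\<Omega>) \<partial>count_space I)"
    by (rule nn_integral_count_space_nn_integral[OF I meas])
  finally show ?thesis .
qed

lemma markov_chain_history_measurable:
  assumes "markov_chain \<Omega> S p Z" and S: "countable S"
  shows "(\<lambda>\<omega>. \<lambda>k\<in>{..n}. Z k \<omega>) \<in> measurable \<Omega> (count_space (PiE {..n} (\<lambda>_. S)))"
proof -
  have Z: "Z k \<in> measurable \<Omega> (count_space S)" for k
    using assms by (simp add: markov_chain_def)
  have fib: "(\<lambda>\<omega>. \<lambda>k\<in>{..n}. Z k \<omega>) -` {h} \<inter> space \<Omega> \<in> sets \<Omega>"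
    if "h \<in> PiE {..n} (\<lambda>_. S)" for h
  proof -
    have "(\<lambda>\<omega>. \<lambda>k\<in>{..n}. Z k \<omega>) -` {h} \<inter> space \<Omega> = (\<Inter>k\<in>{..n}. Z k -` {h k} \<inter> space \<Omega>)"
      using that by (fastforce simp: PiE_def extensional_def restrict_def)
    moreover have "(\<Inter>k\<in>{..n}. Z k -` {h k} \<inter> space \<Omega>) \<in> sets \<Omega>"
      using that by (intro sets.finite_INT measurable_sets[OF Z]) auto
    ultimately show ?thesis
      by (simp only:)
  qed
  have "(\<lambda>\<omega>. \<lambda>k\<in>{..n}. Z k \<omega>) \<in> space \<Omega> \<rightarrow> PiE {..n} (\<lambda>_. S)"
    using measurable_space[OF Z] by auto
  then show ?thesis
    using fib S by (subst measurable_count_space_eq_countable) (auto intro!: countable_PiE)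
qed

text \<open>The definition of a Markov chain conditions on atoms of the history. There are only countably many
atoms, so splitting the integral over them yields the property for an arbitrary weight \<open>f\<close> of the whole
past. The exponential of a walk is such a weight, and it does not depend on the current state alone.\<close>

lemma markov_chain_nn_integral_step:
  fixes f :: "(nat \<Rightarrow> 's) \<Rightarrow> ennreal"
  assumes chain: "markov_chain \<Omega> S p Z" and S: "countable S" and z': "z' \<in> S"
  shows "(\<integral>\<^sup>+\<omega>. f (\<lambda>k\<in>{..n}. Z k \<omega>) * indicator {\<omega>. Z (Suc n) \<omega> = z'} \<omega> \<partial>\<Omega>)
    = (\<integral>\<^sup>+\<omega>. f (\<lambda>k\<in>{..n}. Z k \<omega>) * ennreal (p (Z n \<omega>) z') \<partial>\<Omega>)"
proof -
  interpret prob_space \<Omega>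
    using chain by (simp add: markov_chain_def)
  let ?T = "\<lambda>\<omega>. \<lambda>k\<in>{..n}. Z k \<omega>"
  let ?I = "PiE {..n} (\<lambda>_. S)"
  have Z: "Z k \<in> measurable \<Omega> (count_space S)" for k
    using chain by (simp add: markov_chain_def)
  have T: "?T \<in> measurable \<Omega> (count_space ?I)"
    by (rule markov_chain_history_measurable[OF chain S])
  have I: "countable ?I"
    using S by (auto intro!: countable_PiE)
  have next_ev: "{\<omega> \<in> space \<Omega>. Z (Suc n) \<omega> = z'} \<in> sets \<Omega>"
    using measurable_sets[OF Z, of "{z'}" "Suc n"] z' by (simp add: vimage_def Int_def conj_commute)
  have T_ev: "{\<omega> \<in> space \<Omega>. ?T \<omega> = h} \<in> sets \<Omega>" if "h \<in> ?I" for h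
    using measurable_sets[OF T, of "{h}"] that by (simp add: vimage_def Int_def conj_commute)
  have fT: "(\<lambda>\<omega>. F (?T \<omega>)) \<in> borel_measurable \<Omega>" for F :: "(nat \<Rightarrow> 's) \<Rightarrow> ennreal"
    by (rule measurable_compose[OF T]) simp
  have meas1: "(\<lambda>\<omega>. f (?T \<omega>) * indicator {\<omega>. Z (Suc n) \<omega> = z'} \<omega>) \<in> borel_measurable \<Omega>"
    using next_ev by (intro borel_measurable_times_ennreal fT borel_measurable_indicator')
      (auto simp: Int_def vimage_def)
  have "(\<lambda>\<omega>. ennreal (p (?T \<omega> n) z')) \<in> borel_measurable \<Omega>"
    by (rule fT)
  then have meas2: "(\<lambda>\<omega>. f (?T \<omega>) * ennreal (p (Z n \<omega>) z')) \<in> borel_measurable \<Omega>"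
    by (intro borel_measurable_times_ennreal fT) simp
  have atom: "(\<integral>\<^sup>+\<omega>. f (?T \<omega>) * indicator {\<omega>. Z (Suc n) \<omega> = z'} \<omega> * indicator {\<omega>. ?T \<omega> = h} \<omega> \<partial>\<Omega>)
    = (\<integral>\<^sup>+\<omega>. f (?T \<omega>) * ennreal (p (Z n \<omega>) z') * indicator {\<omega>. ?T \<omega> = h} \<omega> \<partial>\<Omega>)"
    if h: "h \<in> ?I" for h
  proof -
    let ?H = "{\<omega> \<in> space \<Omega>. ?T \<omega> = h}"
    let ?N = "{\<omega> \<in> space \<Omega>. Z (Suc n) \<omega> = z'}"
    have H_eq: "?H = {\<omega> \<in> space \<Omega>. \<forall>k\<le>n. Z k \<omega> = h k}"
      using h by (fastforce simp: PiE_def extensional_def restrict_def)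
    have "(\<integral>\<^sup>+\<omega>. f (?T \<omega>) * indicator {\<omega>. Z (Suc n) \<omega> = z'} \<omega> * indicator {\<omega>. ?T \<omega> = h} \<omega> \<partial>\<Omega>)
        = (\<integral>\<^sup>+\<omega>. f h * indicator (?N \<inter> ?H) \<omega> \<partial>\<Omega>)"
      by (intro nn_integral_cong) (auto split: split_indicator)
    also have "\<dots> = f h * emeasure \<Omega> (?N \<inter> ?H)"
      using next_ev T_ev[OF h] by (intro nn_integral_cmult_indicator) auto
    \<comment> \<open>On null histories nothing is known about \<open>p\<close>, but there both sides vanish.\<close>
    also have "emeasure \<Omega> (?N \<inter> ?H) = ennreal (p (h n) z') * emeasure \<Omega> ?H"
    proof (cases "prob ?H > 0")
      case True
      have "\<P>(\<omega> in \<Omega>. Z (Suc n) \<omega> = z' \<bar> \<forall>k\<le>n. Z k \<omega> = h k) = p (h n) z'"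
        using chain True z' unfolding H_eq markov_chain_def by blast
      moreover have "{\<omega> \<in> space \<Omega>. Z (Suc n) \<omega> = z' \<and> (\<forall>k\<le>n. Z k \<omega> = h k)} = ?N \<inter> ?H"
        unfolding H_eq by auto
      ultimately have "prob (?N \<inter> ?H) / prob ?H = p (h n) z'"
        by (simp add: cond_prob_def H_eq)
      then have eq: "prob (?N \<inter> ?H) = p (h n) z' * prob ?H"
        using True by (simp add: divide_eq_eq)
      have "p (h n) z' \<ge> 0"
        unfolding \<open>prob (?N \<inter> ?H) / prob ?H = p (h n) z'\<close>[symmetric] by simp
      then show ?thesis
        using eq by (simp add: emeasure_eq_measure ennreal_mult)
    next
      case False
      then have "emeasure \<Omega> ?H = 0"
        by (simp add: emeasure_eq_measure not_less measure_le_0_iff)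
      moreover have "emeasure \<Omega> (?N \<inter> ?H) \<le> emeasure \<Omega> ?H"
        using T_ev[OF h] by (intro emeasure_mono) auto
      ultimately show ?thesis
        by simp
    qed
    also have "f h * (ennreal (p (h n) z') * emeasure \<Omega> ?H)
        = (\<integral>\<^sup>+\<omega>. f h * ennreal (p (h n) z') * indicator ?H \<omega> \<partial>\<Omega>)"
      using T_ev[OF h] by (subst nn_integral_cmult_indicator) (auto simp: mult.assoc)
    also have "\<dots> = (\<integral>\<^sup>+\<omega>. f (?T \<omega>) * ennreal (p (Z n \<omega>) z') * indicator {\<omega>. ?T \<omega> = h} \<omega> \<partial>\<Omega>)"
      by (intro nn_integral_cong) (auto split: split_indicator)
    finally show ?thesis .
  qed
  show ?thesis
    unfolding nn_integral_split_countable[OF T I meas1] nn_integral_split_countable[OF T I meas2]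
    by (rule nn_integral_cong) (simp add: atom)
qed

text \<open>Restricting the measure to the event on \<open>X\<close> scales the law of \<open>Y\<close> by the probability of the event;
this equality of measures extends the product rule from sets to functions of \<open>Y\<close>.\<close>

lemma indep_rv_nn_integral_indicator:
  assumes "prob_space \<Omega>" and indep: "indep_rv \<Omega> A X B Y"
    and E: "E \<in> sets A" and g [measurable]: "g \<in> borel_measurable B"
  shows "(\<integral>\<^sup>+\<omega>. indicator E (X \<omega>) * g (Y \<omega>) \<partial>\<Omega>)
    = emeasure \<Omega> (X -` E \<inter> space \<Omega>) * (\<integral>\<^sup>+\<omega>. g (Y \<omega>) \<partial>\<Omega>)"
proof -
  interpret prob_space \<Omega> by fact
  have X [measurable]: "X \<in> measurable \<Omega> A" and Y [measurable]: "Y \<in> measurable \<Omega> B"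
    and ind: "indep_set (sets (vimage_algebra (space \<Omega>) X A)) (sets (vimage_algebra (space \<Omega>) Y B))"
    using indep by (auto simp: indep_rv_def)
  let ?E = "X -` E \<inter> space \<Omega>"
  have E' [measurable]: "?E \<in> sets \<Omega>"
    using X E by (rule measurable_sets)
  have "distr (density \<Omega> (indicator ?E)) B Y = scale_measure (emeasure \<Omega> ?E) (distr \<Omega> B Y)"
  proof (rule measure_eqI)
    fix F assume "F \<in> sets (distr (density \<Omega> (indicator ?E)) B Y)"
    then have F: "F \<in> sets B" by simp
    have "prob (?E \<inter> (Y -` F \<inter> space \<Omega>)) = prob ?E * prob (Y -` F \<inter> space \<Omega>)"
      using ind in_vimage_algebra[OF E, of X "space \<Omega>"] in_vimage_algebra[OF F, of Y "space \<Omega>"]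
      unfolding indep_sets2_eq by blast
    then show "emeasure (distr (density \<Omega> (indicator ?E)) B Y) F
        = emeasure (scale_measure (emeasure \<Omega> ?E) (distr \<Omega> B Y)) F"
      using F measurable_sets[OF Y F]
      by (simp add: emeasure_distr emeasure_density emeasure_eq_measure ennreal_mult
          flip: indicator_inter_arith)
  qed simp
  then have "(\<integral>\<^sup>+y. g y \<partial>distr (density \<Omega> (indicator ?E)) B Y)
      = emeasure \<Omega> ?E * (\<integral>\<^sup>+y. g y \<partial>distr \<Omega> B Y)"
    by (simp add: nn_integral_scale_measure)
  then have "(\<integral>\<^sup>+\<omega>. indicator ?E \<omega> * g (Y \<omega>) \<partial>\<Omega>) = emeasure \<Omega> ?E * (\<integral>\<^sup>+\<omega>. g (Y \<omega>) \<partial>\<Omega>)"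
    by (simp add: nn_integral_distr nn_integral_density)
  moreover have "(\<integral>\<^sup>+\<omega>. indicator E (X \<omega>) * g (Y \<omega>) \<partial>\<Omega>) = (\<integral>\<^sup>+\<omega>. indicator ?E \<omega> * g (Y \<omega>) \<partial>\<Omega>)"
    by (intro nn_integral_cong) (auto split: split_indicator)
  ultimately show ?thesis by simp
qed

section \<open>Survival series and the closing linear system\<close>

lemma cal_P_bounds:
  assumes "\<And>n. n \<ge> 1 \<Longrightarrow> \<alpha> i n \<in> {0<..<1}"
  shows "0 < cal_P \<alpha> i m" and "cal_P \<alpha> i m \<le> 1"
proof -
  have a: "0 < 1 - \<alpha> i k \<and> 1 - \<alpha> i k \<le> 1" if "k \<in> {1..<m}" for k
    using assms[of k] that by auto
  show "0 < cal_P \<alpha> i m"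
    unfolding cal_P_def using a by (intro prod_pos) blast
  show "cal_P \<alpha> i m \<le> 1"
    unfolding cal_P_def using a by (intro prod_le_1) (auto simp: less_imp_le)
qed

lemma cal_P_Suc: "cal_P \<alpha> i (Suc (Suc n)) = (1 - \<alpha> i (Suc n)) * cal_P \<alpha> i (Suc n)"
  by (simp add: cal_P_def prod.atLeastLessThan_Suc mult.commute)

text \<open>The probability of switching at a given age is the difference of consecutive survival probabilities,
so the second series is the first one minus its shift.\<close>

lemma hat_P_sums:
  assumes "\<And>n. n \<ge> 1 \<Longrightarrow> \<alpha> i n \<in> {0<..<1}" and y: "0 < y" "y < 1"
  shows "(\<lambda>n. cal_P \<alpha> i (Suc n) * y ^ n) sums (hat_P \<alpha> i y / y)"
    and "(\<lambda>n. \<alpha> i (Suc n) * (cal_P \<alpha> i (Suc n) * y ^ n)) sums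
           ((1 + hat_P \<alpha> i y * (1 - 1 / y)) / y)"
proof -
  let ?P = "cal_P \<alpha> i"
  have "summable (\<lambda>n. ?P (Suc n) * y ^ n)"
  proof (rule summable_comparison_test')
    show "summable (\<lambda>n. y ^ n)" using y by simp
    show "norm (?P (Suc n) * y ^ n) \<le> y ^ n" if "n \<ge> 0" for n
      using cal_P_bounds[where \<alpha> = \<alpha> and i = i and m = "Suc n", OF assms(1)] y
      by (simp add: abs_mult mult_left_le_one_le)
  qed
  then have "summable (\<lambda>n. y * (?P (Suc n) * y ^ n))"
    by (rule summable_mult)
  then have "(\<lambda>n. ?P (Suc n) * y ^ Suc n) sums hat_P \<alpha> i y"
    unfolding hat_P_def by (intro summable_sums) (simp add: mult_ac)
  from sums_divide[OF this, of y]
  show s: "(\<lambda>n. ?P (Suc n) * y ^ n) sums (hat_P \<alpha> i y / y)"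
    using y by simp
  have "(\<lambda>n. ?P (Suc (Suc n)) * y ^ Suc n) sums (hat_P \<alpha> i y / y - 1)"
    using s by (subst sums_Suc_iff) (simp add: cal_P_def)
  from sums_divide[OF this, of y]
  have "(\<lambda>n. ?P (Suc (Suc n)) * y ^ n) sums ((hat_P \<alpha> i y / y - 1) / y)"
    using y by simp
  from sums_diff[OF s this]
  show "(\<lambda>n. \<alpha> i (Suc n) * (?P (Suc n) * y ^ n)) sums ((1 + hat_P \<alpha> i y * (1 - 1 / y)) / y)"
    using y by (simp add: cal_P_Suc algebra_simps diff_divide_distrib add_divide_distrib)
qed

text \<open>Here \<open>A\<close> and \<open>B\<close> are the weights of the starts of runs of \<open>1\<close> and of \<open>-1\<close>. Eliminating \<open>B\<close>
leaves \<open>A * (1 - q1 * q2) = l\<close>, where \<open>q1\<close> and \<open>q2\<close> are the weights of one complete run of each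
letter. Since \<open>l\<close> is nonzero, so is \<open>1 - q1 * q2\<close>, which up to a nonzero factor is the denominator of
the formula; existence of a solution thus already excludes a division by zero.\<close>

lemma switching_system_solution:
  fixes l \<rho> P1 P2 A B :: real
  assumes pos: "0 < l" "0 < \<rho>"
    and A: "A = l + l * \<rho> * (B * ((1 + P1 * (1 - 1 / (\<rho> / l))) / (\<rho> / l)))"
    and B: "B = \<rho> / l * (A * ((1 + P2 * (1 - 1 / (l * \<rho>))) / (l * \<rho>)))"
  shows "(1 - \<rho>) * (A * (P2 / (l * \<rho>)) + B * (P1 / (\<rho> / l))) =
    ((\<rho> - 1) * (l * \<rho> * (P1 + P2) + (l * \<rho> - 1) * P1 * P2)) /
        (\<rho> * (l * \<rho> - 1) * P2 + l * \<rho> * (\<rho> - l) * P1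
          + (l * \<rho> - 1) * (\<rho> - l) * P1 * P2)"
proof -
  define q1 where "q1 = 1 + P1 * (1 - l / \<rho>)"
  define q2 where "q2 = 1 + P2 * (1 - 1 / (l * \<rho>))"
  let ?N = "(\<rho> - 1) * (l * \<rho> * (P1 + P2) + (l * \<rho> - 1) * P1 * P2)"
  let ?D = "\<rho> * (l * \<rho> - 1) * P2 + l * \<rho> * (\<rho> - l) * P1 + (l * \<rho> - 1) * (\<rho> - l) * P1 * P2"
  have B': "B = A * q2 / (l * l)"
    using B pos by (simp add: q2_def)
  have "A = l + l * l * B * q1"
    using A pos by (simp add: q1_def)
  then have Aq: "A * (1 - q1 * q2) = l"
    using pos by (simp add: B' algebra_simps)
  have D: "?D = - (l * \<rho> * \<rho>) * (1 - q1 * q2)"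
    using pos by (simp add: q1_def q2_def field_simps)
  have "A * ?D = - (l * \<rho> * \<rho>) * (A * (1 - q1 * q2))"
    unfolding D by (simp only: mult_ac mult_minus_left mult_minus_right)
  then have AD: "A * ?D = - (l * \<rho> * \<rho>) * l"
    unfolding Aq .
  then have "?D \<noteq> 0"
    using pos by force
  have "(1 - \<rho>) * (A * (P2 / (l * \<rho>)) + B * (P1 / (\<rho> / l)))
      = (1 - \<rho>) * A * (P2 + P1 * q2) / (l * \<rho>)"
    using pos by (simp add: B' field_simps)
  also have "\<dots> = - (A * ?N) / (l * l * \<rho> * \<rho>)"
    using pos by (simp add: q2_def field_simps)
  finally have E: "(1 - \<rho>) * (A * (P2 / (l * \<rho>)) + B * (P1 / (\<rho> / l))) = - (A * ?N) / (l * l * \<rho> * \<rho>)" .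
  have "- (A * ?N) / (l * l * \<rho> * \<rho>) * ?D = - (A * ?D) * ?N / (l * l * \<rho> * \<rho>)"
    by simp
  also have "\<dots> = ?N"
    unfolding AD using pos by simp
  finally show ?thesis
    unfolding E using \<open>?D \<noteq> 0\<close> by (simp add: eq_divide_eq)
qed


section \<open>Exponential weights of the walk by state\<close>

locale switching_walk = prob_space \<Omega>
  for \<Omega> :: "'w measure" +
  fixes \<alpha> :: "nat \<Rightarrow> nat \<Rightarrow> real" and X :: "nat \<Rightarrow> 'w \<Rightarrow> int" and M :: "nat \<Rightarrow> 'w \<Rightarrow> nat"
    and l :: real
  assumes alpha: "\<And>i n. i \<in> {1, 2} \<Longrightarrow> n \<ge> 1 \<Longrightarrow> \<alpha> i n \<in> {0<..<1}"
    and chain: "markov_chain \<Omega> state_space (trans_prob \<alpha>) (\<lambda>n \<omega>. (X n \<omega>, M n \<omega>))"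
    and init: "AE \<omega> in \<Omega>. (X 0 \<omega>, M 0 \<omega>) = (1, 1)"
    and l_pos: "0 < l"
begin

lemma countable_state_space: "countable state_space"
  by (simp add: state_space_def)

lemma state_measurable: "(\<lambda>\<omega>. (X n \<omega>, M n \<omega>)) \<in> measurable \<Omega> (count_space state_space)"
  using chain by (simp add: markov_chain_def)

lemma state_in:
  assumes "\<omega> \<in> space \<Omega>"
  shows "X n \<omega> = -1 \<or> X n \<omega> = 1" and "M n \<omega> \<ge> 1"
  using measurable_space[OF state_measurable assms, of n] by (auto simp: state_space_def)

lemma X_measurable [measurable]: "X n \<in> measurable \<Omega> (count_space UNIV)"
  and M_measurable [measurable]: "M n \<in> measurable \<Omega> (count_space UNIV)"
  using measurable_compose[OF state_measurable[of n], of fst "count_space UNIV"]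
    measurable_compose[OF state_measurable[of n], of snd "count_space UNIV"] by simp_all

lemma walk_history:
  "walk X n \<omega> = (\<Sum>k\<le>n. fst ((\<lambda>k\<in>{..n}. (X k \<omega>, M k \<omega>)) k))"
  by (simp add: walk_def atMost_atLeast0)

lemma walk_measurable [measurable]: "walk X n \<in> measurable \<Omega> (count_space UNIV)"
  unfolding walk_history[abs_def]
  by (rule measurable_compose[OF markov_chain_history_measurable[OF chain countable_state_space]]) simp

text \<open>The age is shifted by one: \<open>n\<close> counts the steps since the start of the current run, so that
\<open>n = 0\<close> is the state in which a run begins.\<close>

definition state_mass :: "nat \<Rightarrow> int \<Rightarrow> nat \<Rightarrow> ennreal" where
  "state_mass k x n =
    (\<integral>\<^sup>+\<omega>. ennreal (l powi walk X k \<omega>) * indicator {\<omega>. X k \<omega> = x \<and> M k \<omega> = Suc n} \<omega> \<partial>\<Omega>)"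

lemma state_mass_Suc:
  assumes x: "x \<in> {-1, 1}"
  shows "state_mass (Suc k) x n = ennreal (l powi x) *
    (\<integral>\<^sup>+\<omega>. ennreal (l powi walk X k \<omega>) * ennreal (trans_prob \<alpha> (X k \<omega>, M k \<omega>) (x, Suc n)) \<partial>\<Omega>)"
proof -
  have split: "ennreal (l powi walk X (Suc k) \<omega>) * indicator {\<omega>. X (Suc k) \<omega> = x \<and> M (Suc k) \<omega> = Suc n} \<omega>
    = ennreal (l powi x) * (ennreal (l powi walk X k \<omega>)
        * indicator {\<omega>. (X (Suc k) \<omega>, M (Suc k) \<omega>) = (x, Suc n)} \<omega>)" for \<omega>
    using l_pos by (auto simp: walk_def power_int_add ennreal_mult mult_ac split: split_indicator)
  let ?f = "\<lambda>h :: nat \<Rightarrow> int \<times> nat. ennreal (l powi (\<Sum>j\<le>k. fst (h j)))"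
  have "(\<integral>\<^sup>+\<omega>. ennreal (l powi walk X k \<omega>)
        * indicator {\<omega>. (X (Suc k) \<omega>, M (Suc k) \<omega>) = (x, Suc n)} \<omega> \<partial>\<Omega>)
    = (\<integral>\<^sup>+\<omega>. ennreal (l powi walk X k \<omega>) * ennreal (trans_prob \<alpha> (X k \<omega>, M k \<omega>) (x, Suc n)) \<partial>\<Omega>)"
    unfolding walk_history
    by (rule markov_chain_nn_integral_step[OF chain countable_state_space, where f = ?f])
      (use x in \<open>auto simp: state_space_def\<close>)
  then show ?thesis
    unfolding state_mass_def split by (subst nn_integral_cmult) simp_all
qed

text \<open>Above age one, the only predecessor of a state is the state of the same run that is one step younger.\<close>

lemma state_mass_stay:
  assumes x: "x \<in> {-1, 1}"
  shows "state_mass (Suc k) x (Suc n)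
    = ennreal (l powi x * (1 - \<alpha> (letter_index x) (Suc n))) * state_mass k x n"
proof -
  have a: "0 \<le> 1 - \<alpha> (letter_index x) (Suc n)"
    using alpha[of "letter_index x" "Suc n"] by (auto simp: letter_index_def)
  have "(\<integral>\<^sup>+\<omega>. ennreal (l powi walk X k \<omega>) * ennreal (trans_prob \<alpha> (X k \<omega>, M k \<omega>) (x, Suc (Suc n))) \<partial>\<Omega>)
    = (\<integral>\<^sup>+\<omega>. ennreal (1 - \<alpha> (letter_index x) (Suc n)) * (ennreal (l powi walk X k \<omega>)
        * indicator {\<omega>. X k \<omega> = x \<and> M k \<omega> = Suc n} \<omega>) \<partial>\<Omega>)"
    by (intro nn_integral_cong) (auto simp: trans_prob_def mult_ac split: split_indicator)
  also have "\<dots> = ennreal (1 - \<alpha> (letter_index x) (Suc n)) * state_mass k x n"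
    unfolding state_mass_def by (subst nn_integral_cmult) simp_all
  finally show ?thesis
    using a l_pos by (simp add: state_mass_Suc[OF x] ennreal_mult mult.assoc)
qed

lemma nn_integral_split_run:
  assumes x: "x \<in> {-1, 1}"
  shows "(\<integral>\<^sup>+\<omega>. ennreal (l powi walk X k \<omega>) * c (M k \<omega>) * indicator {\<omega>. X k \<omega> = x} \<omega> \<partial>\<Omega>)
    = (\<Sum>n. c (Suc n) * state_mass k x n)"
proof -
  have "(\<Sum>n. c (Suc n) * state_mass k x n) = (\<Sum>n. \<integral>\<^sup>+\<omega>. c (Suc n) *
      (ennreal (l powi walk X k \<omega>) * indicator {\<omega>. X k \<omega> = x \<and> M k \<omega> = Suc n} \<omega>) \<partial>\<Omega>)"
    unfolding state_mass_def by (subst nn_integral_cmult) simp_all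
  also have "\<dots> = (\<integral>\<^sup>+\<omega>. (\<Sum>n. c (Suc n) *
      (ennreal (l powi walk X k \<omega>) * indicator {\<omega>. X k \<omega> = x \<and> M k \<omega> = Suc n} \<omega>)) \<partial>\<Omega>)"
    by (rule nn_integral_suminf[symmetric]) simp
  also have "\<dots> = (\<integral>\<^sup>+\<omega>. ennreal (l powi walk X k \<omega>) * c (M k \<omega>) * indicator {\<omega>. X k \<omega> = x} \<omega> \<partial>\<Omega>)"
  proof (rule nn_integral_cong)
    fix \<omega> assume "\<omega> \<in> space \<Omega>"
    then obtain m where m: "M k \<omega> = Suc m"
      using state_in(2)[of \<omega> k] by (cases "M k \<omega>") auto
    have "(\<Sum>n. c (Suc n) *
        (ennreal (l powi walk X k \<omega>) * indicator {\<omega>. X k \<omega> = x \<and> M k \<omega> = Suc n} \<omega>))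
      = (\<Sum>n\<in>{m}. c (Suc n) *
        (ennreal (l powi walk X k \<omega>) * indicator {\<omega>. X k \<omega> = x \<and> M k \<omega> = Suc n} \<omega>))"
      by (rule suminf_finite) (auto simp: m split: split_indicator)
    then show "(\<Sum>n. c (Suc n) *
        (ennreal (l powi walk X k \<omega>) * indicator {\<omega>. X k \<omega> = x \<and> M k \<omega> = Suc n} \<omega>))
      = ennreal (l powi walk X k \<omega>) * c (M k \<omega>) * indicator {\<omega>. X k \<omega> = x} \<omega>"
      by (auto simp: m mult_ac split: split_indicator)
  qed
  finally show ?thesis ..
qed

text \<open>A run of \<open>x\<close> begins by leaving a run of the other letter, which may have any age.\<close>

lemma state_mass_switch:
  assumes x: "x \<in> {-1, 1}"
  shows "state_mass (Suc k) x 0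
    = ennreal (l powi x) * (\<Sum>n. ennreal (\<alpha> (letter_index (- x)) (Suc n)) * state_mass k (- x) n)"
proof -
  have "(\<integral>\<^sup>+\<omega>. ennreal (l powi walk X k \<omega>) * ennreal (trans_prob \<alpha> (X k \<omega>, M k \<omega>) (x, Suc 0)) \<partial>\<Omega>)
    = (\<integral>\<^sup>+\<omega>. ennreal (l powi walk X k \<omega>) * ennreal (\<alpha> (letter_index (- x)) (M k \<omega>))
        * indicator {\<omega>. X k \<omega> = - x} \<omega> \<partial>\<Omega>)"
  proof (rule nn_integral_cong)
    fix \<omega> assume "\<omega> \<in> space \<Omega>"
    then have "M k \<omega> \<noteq> 0" "x \<noteq> 0"
      using state_in(2)[of \<omega> k] x by auto
    then show "ennreal (l powi walk X k \<omega>) * ennreal (trans_prob \<alpha> (X k \<omega>, M k \<omega>) (x, Suc 0))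
      = ennreal (l powi walk X k \<omega>) * ennreal (\<alpha> (letter_index (- x)) (M k \<omega>))
        * indicator {\<omega>. X k \<omega> = - x} \<omega>"
      by (auto simp: trans_prob_def split: split_indicator)
  qed
  also have "\<dots> = (\<Sum>n. ennreal (\<alpha> (letter_index (- x)) (Suc n)) * state_mass k (- x) n)"
    using x by (intro nn_integral_split_run[where c = "\<lambda>m. ennreal (\<alpha> (letter_index (- x)) m)"]) auto
  finally show ?thesis
    by (simp add: state_mass_Suc[OF x])
qed

lemma state_mass_0: "state_mass 0 x n = (if x = 1 \<and> n = 0 then ennreal l else 0)"
proof -
  have "state_mass 0 x n = (\<integral>\<^sup>+\<omega>. (if x = 1 \<and> n = 0 then ennreal l else 0) \<partial>\<Omega>)"
    unfolding state_mass_def using init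
    by (intro nn_integral_cong_AE, elim AE_mp, intro AE_I2)
      (auto simp: walk_def split: split_indicator)
  then show ?thesis
    by (simp add: emeasure_space_1)
qed

lemma total_mass: "(\<integral>\<^sup>+\<omega>. ennreal (l powi walk X k \<omega>) \<partial>\<Omega>)
  = (\<Sum>n. state_mass k 1 n) + (\<Sum>n. state_mass k (-1) n)"
proof -
  have "(\<integral>\<^sup>+\<omega>. ennreal (l powi walk X k \<omega>) \<partial>\<Omega>)
    = (\<integral>\<^sup>+\<omega>. ennreal (l powi walk X k \<omega>) * 1 * indicator {\<omega>. X k \<omega> = 1} \<omega>
        + ennreal (l powi walk X k \<omega>) * 1 * indicator {\<omega>. X k \<omega> = -1} \<omega> \<partial>\<Omega>)"
    using state_in(1)[of _ k] by (intro nn_integral_cong) (force split: split_indicator)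
  also have "\<dots> = (\<integral>\<^sup>+\<omega>. ennreal (l powi walk X k \<omega>) * 1 * indicator {\<omega>. X k \<omega> = 1} \<omega> \<partial>\<Omega>)
      + (\<integral>\<^sup>+\<omega>. ennreal (l powi walk X k \<omega>) * 1 * indicator {\<omega>. X k \<omega> = -1} \<omega> \<partial>\<Omega>)"
    by (rule nn_integral_add) simp_all
  finally show ?thesis
    by (simp add: nn_integral_split_run[where c = "\<lambda>_. 1", simplified])
qed

text \<open>The worst case is a walk that only steps down, because \<open>l < 1\<close>.\<close>

lemma total_mass_le:
  assumes "l < 1"
  shows "(\<integral>\<^sup>+\<omega>. ennreal (l powi walk X k \<omega>) \<partial>\<Omega>) \<le> ennreal ((1 / l) ^ Suc k)"
proof -
  have "l powi walk X k \<omega> \<le> (1 / l) ^ Suc k" if "\<omega> \<in> space \<Omega>" for \<omega>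
  proof -
    have "(\<Sum>j=0..k. - 1) \<le> (\<Sum>j=0..k. X j \<omega>)"
    proof (rule sum_mono)
      show "- 1 \<le> X j \<omega>" for j
        using state_in(1)[OF that, of j] by auto
    qed
    then have "- int (Suc k) \<le> walk X k \<omega>"
      by (simp add: walk_def)
    then have "l powi walk X k \<omega> \<le> l powi (- int (Suc k))"
      using l_pos assms by (intro power_int_decreasing) auto
    then show ?thesis
      by (simp only: power_int_minus power_int_of_nat power_inverse flip: inverse_eq_divide)
  qed
  then have "(\<integral>\<^sup>+\<omega>. ennreal (l powi walk X k \<omega>) \<partial>\<Omega>) \<le> (\<integral>\<^sup>+\<omega>. ennreal ((1 / l) ^ Suc k) \<partial>\<Omega>)"
    by (intro nn_integral_mono ennreal_leI)
  then show ?thesis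
    by (simp add: emeasure_space_1)
qed

section \<open>Generating functions in time\<close>

context
  fixes \<rho> :: real
  assumes rho: "0 < \<rho>" "\<rho> < l" and l_less: "l < 1"
begin

definition state_gf :: "int \<Rightarrow> nat \<Rightarrow> ennreal" where
  "state_gf x n = (\<Sum>k. ennreal (\<rho> ^ k) * state_mass k x n)"

lemma state_gf_shift: "state_gf x n = state_mass 0 x n + ennreal \<rho> * (\<Sum>k. ennreal (\<rho> ^ k) * state_mass (Suc k) x n)"
proof -
  have "state_gf x n = ennreal (\<rho> ^ 0) * state_mass 0 x n + (\<Sum>k. ennreal (\<rho> ^ Suc k) * state_mass (Suc k) x n)"
    unfolding state_gf_def by (subst suminf_offset[where i = 1]) (simp_all add: add.commute)
  then show ?thesis
    using rho by (simp add: ennreal_mult mult.assoc)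
qed

lemma state_gf_run:
  assumes x: "x \<in> {-1, 1}"
  shows "state_gf x n = state_gf x 0 * ennreal (cal_P \<alpha> (letter_index x) (Suc n) * (\<rho> * l powi x) ^ n)"
proof (induction n)
  case 0
  then show ?case by (simp add: cal_P_def)
next
  case (Suc n)
  let ?i = "letter_index x"
  have i: "?i \<in> {1, 2}"
    by (simp add: letter_index_def)
  have nn: "0 \<le> 1 - \<alpha> ?i (Suc n)" "0 \<le> cal_P \<alpha> ?i (Suc n)" "0 \<le> \<rho> * l powi x"
    using alpha[OF i, of "Suc n"] cal_P_bounds(1)[where \<alpha> = \<alpha> and i = ?i, OF alpha[OF i]] rho l_pos
    by (auto simp: less_imp_le)
  have "state_gf x (Suc n) = ennreal (\<rho> * l powi x * (1 - \<alpha> ?i (Suc n))) * state_gf x n"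
  proof -
    have "state_gf x (Suc n) = ennreal \<rho> * (\<Sum>k. ennreal (l powi x * (1 - \<alpha> ?i (Suc n))) * (ennreal (\<rho> ^ k) * state_mass k x n))"
      unfolding state_gf_shift[of x "Suc n"] state_mass_stay[OF x] by (simp add: state_mass_0 mult.left_commute)
    also have "\<dots> = ennreal (\<rho> * (l powi x * (1 - \<alpha> ?i (Suc n)))) * state_gf x n"
      unfolding ennreal_suminf_cmult state_gf_def[symmetric] using rho
      by (simp add: ennreal_mult' mult.assoc)
    finally show ?thesis
      by (simp add: mult.assoc)
  qed
  also have "\<dots> = state_gf x 0 * ennreal (cal_P \<alpha> ?i (Suc (Suc n)) * (\<rho> * l powi x) ^ Suc n)"
    unfolding Suc.IH
  proof (subst mult.left_commute, rule arg_cong[where f = "\<lambda>c. state_gf x 0 * c"])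
    have "ennreal (cal_P \<alpha> ?i (Suc (Suc n)) * (\<rho> * l powi x) ^ Suc n)
      = ennreal ((\<rho> * l powi x * (1 - \<alpha> ?i (Suc n))) * (cal_P \<alpha> ?i (Suc n) * (\<rho> * l powi x) ^ n))"
      by (simp only: cal_P_Suc power_Suc mult_ac)
    also have "\<dots> = ennreal (\<rho> * l powi x * (1 - \<alpha> ?i (Suc n)))
        * ennreal (cal_P \<alpha> ?i (Suc n) * (\<rho> * l powi x) ^ n)"
      using nn(1,2) rho l_pos by (intro ennreal_mult mult_nonneg_nonneg zero_le_power) auto
    finally show "ennreal (\<rho> * l powi x * (1 - \<alpha> ?i (Suc n)))
        * ennreal (cal_P \<alpha> ?i (Suc n) * (\<rho> * l powi x) ^ n)
      = ennreal (cal_P \<alpha> ?i (Suc (Suc n)) * (\<rho> * l powi x) ^ Suc n)" ..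
  qed
  finally show ?case .
qed

lemma state_gf_switch:
  assumes x: "x \<in> {-1, 1}"
  shows "state_gf x 0 = (if x = 1 then ennreal l else 0)
    + ennreal (\<rho> * l powi x) * (\<Sum>n. ennreal (\<alpha> (letter_index (- x)) (Suc n)) * state_gf (- x) n)"
proof -
  let ?a = "\<lambda>n. ennreal (\<alpha> (letter_index (- x)) (Suc n))"
  have "(\<Sum>k. ennreal (\<rho> ^ k) * state_mass (Suc k) x 0)
      = (\<Sum>k. ennreal (l powi x) * (\<Sum>n. ?a n * (ennreal (\<rho> ^ k) * state_mass k (- x) n)))"
  proof (rule suminf_cong)
    fix k
    have "(\<Sum>n. ?a n * (ennreal (\<rho> ^ k) * state_mass k (- x) n))
      = (\<Sum>n. ennreal (\<rho> ^ k) * (?a n * state_mass k (- x) n))"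
      by (rule suminf_cong) (rule mult.left_commute)
    then show "ennreal (\<rho> ^ k) * state_mass (Suc k) x 0
      = ennreal (l powi x) * (\<Sum>n. ?a n * (ennreal (\<rho> ^ k) * state_mass k (- x) n))"
      unfolding state_mass_switch[OF x] ennreal_suminf_cmult by (simp only: mult.left_commute)
  qed
  also have "\<dots> = ennreal (l powi x) * (\<Sum>n. \<Sum>k. ?a n * (ennreal (\<rho> ^ k) * state_mass k (- x) n))"
    unfolding ennreal_suminf_cmult by (subst suminf_swap) simp
  also have "\<dots> = ennreal (l powi x) * (\<Sum>n. ?a n * state_gf (- x) n)"
    by (simp add: state_gf_def)
  finally show ?thesis
    using rho l_pos by (simp add: state_gf_shift[of x 0] state_mass_0 ennreal_mult mult.assoc)
qed

lemma state_gf_total: "(\<Sum>k. ennreal (\<rho> ^ k) * (\<integral>\<^sup>+\<omega>. ennreal (l powi walk X k \<omega>) \<partial>\<Omega>))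
  = (\<Sum>n. state_gf 1 n) + (\<Sum>n. state_gf (-1) n)"
proof -
  have "(\<Sum>n. state_gf x n) = (\<Sum>k. ennreal (\<rho> ^ k) * (\<Sum>n. state_mass k x n))" for x
    unfolding state_gf_def by (subst suminf_swap) simp
  then show ?thesis
    by (simp add: total_mass distrib_left flip: suminf_add)
qed

text \<open>The bound by the walk that only steps down leaves a geometric series of ratio \<open>\<rho> / l\<close>.\<close>

lemma state_gf_total_finite: "(\<Sum>k. ennreal (\<rho> ^ k) * (\<integral>\<^sup>+\<omega>. ennreal (l powi walk X k \<omega>) \<partial>\<Omega>)) < top"
proof -
  have "(\<Sum>k. ennreal (\<rho> ^ k) * (\<integral>\<^sup>+\<omega>. ennreal (l powi walk X k \<omega>) \<partial>\<Omega>))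
    \<le> (\<Sum>k. ennreal (\<rho> ^ k) * ennreal ((1 / l) ^ Suc k))"
    using total_mass_le[OF l_less] by (intro suminf_le mult_left_mono) auto
  also have "\<dots> = (\<Sum>k. ennreal (1 / l * (\<rho> / l) ^ k))"
  proof (rule suminf_cong)
    fix k
    have "ennreal (\<rho> ^ k) * ennreal ((1 / l) ^ Suc k) = ennreal (\<rho> ^ k * (1 / l) ^ Suc k)"
      using rho l_pos by (intro ennreal_mult[symmetric]) auto
    then show "ennreal (\<rho> ^ k) * ennreal ((1 / l) ^ Suc k) = ennreal (1 / l * (\<rho> / l) ^ k)"
      by (simp add: power_divide)
  qed
  also have "\<dots> = ennreal (1 / l * (1 / (1 - \<rho> / l)))"
    using rho l_pos by (intro suminf_ennreal_eq sums_mult geometric_sums) auto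
  finally show ?thesis
    using le_less_trans ennreal_less_top by blast
qed

text \<open>The two equations of \<open>state_gf_switch\<close>, with the ages summed out by \<open>state_gf_run\<close>, are a closed
system for the starts of runs. It is transferred to the reals through finiteness of the total, and the
sign of \<open>V\<close> comes for free from its representation by nonnegative weights.\<close>

lemma generating_function:
  assumes V: "V = (let P1 = hat_P \<alpha> 1 (\<rho> / l); P2 = hat_P \<alpha> 2 (l * \<rho>) in
        ((\<rho> - 1) * (l * \<rho> * (P1 + P2) + (l * \<rho> - 1) * P1 * P2)) /
        (\<rho> * (l * \<rho> - 1) * P2 + l * \<rho> * (\<rho> - l) * P1
          + (l * \<rho> - 1) * (\<rho> - l) * P1 * P2))"
  shows "ennreal (1 - \<rho>) * (\<Sum>k. ennreal (\<rho> ^ k) * (\<integral>\<^sup>+\<omega>. ennreal (l powi walk X k \<omega>) \<partial>\<Omega>)) = ennreal V"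
    and "0 \<le> V"
proof -
  define y :: "int \<Rightarrow> real" where "y x = \<rho> * l powi x" for x
  define P where "P x = hat_P \<alpha> (letter_index x) (y x)" for x
  define Q where "Q x = 1 + P x * (1 - 1 / y x)" for x
  have y1: "y 1 = l * \<rho>" and ym: "y (-1) = \<rho> / l"
    by (simp_all add: y_def power_int_minus field_simps)
  have "l * \<rho> < 1"
    using rho l_less mult_strict_mono[of l 1 \<rho> 1] by simp
  then have y: "0 < y x" "y x < 1" if "x \<in> {-1, 1}" for x
    using that rho l_pos by (auto simp: y1 ym)
  have i: "letter_index x \<in> {1, 2}" for x
    by (simp add: letter_index_def)
  have ser: "(\<lambda>n. cal_P \<alpha> (letter_index x) (Suc n) * y x ^ n) sums (P x / y x)"
    "(\<lambda>n. \<alpha> (letter_index x) (Suc n) * (cal_P \<alpha> (letter_index x) (Suc n) * y x ^ n)) sums (Q x / y x)"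
    if "x \<in> {-1, 1}" for x
    unfolding P_def Q_def using y[OF that] alpha[OF i] by (auto intro!: hat_P_sums)
  have pos: "0 \<le> cal_P \<alpha> (letter_index x) (Suc n) * y x ^ n" "0 \<le> \<alpha> (letter_index x) (Suc n)"
    if "x \<in> {-1, 1}" for x n
    using cal_P_bounds(1)[where \<alpha> = \<alpha>, OF alpha[OF i]] alpha[OF i, of "Suc n" x] y[OF that]
    by (auto simp: less_imp_le)
  have geo: "state_gf x n = state_gf x 0 * ennreal (cal_P \<alpha> (letter_index x) (Suc n) * y x ^ n)"
    if "x \<in> {-1, 1}" for x n
    unfolding y_def by (rule state_gf_run[OF that])
  have run: "(\<Sum>n. state_gf x n) = state_gf x 0 * ennreal (P x / y x)" if "x \<in> {-1, 1}" for x
  proof -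
    have "(\<Sum>n. state_gf x n) = (\<Sum>n. state_gf x 0 * ennreal (cal_P \<alpha> (letter_index x) (Suc n) * y x ^ n))"
      by (rule suminf_cong) (rule geo[OF that])
    also have "\<dots> = state_gf x 0 * ennreal (P x / y x)"
      unfolding ennreal_suminf_cmult
      using suminf_ennreal_eq[OF pos(1)[OF that] ser(1)[OF that]] by simp
    finally show ?thesis .
  qed
  have swi: "(\<Sum>n. ennreal (\<alpha> (letter_index x) (Suc n)) * state_gf x n) = state_gf x 0 * ennreal (Q x / y x)"
    if "x \<in> {-1, 1}" for x
  proof -
    have "(\<Sum>n. ennreal (\<alpha> (letter_index x) (Suc n)) * state_gf x n)
      = (\<Sum>n. state_gf x 0 * ennreal (\<alpha> (letter_index x) (Suc n) * (cal_P \<alpha> (letter_index x) (Suc n) * y x ^ n)))"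
      by (rule suminf_cong, subst geo[OF that])
        (simp only: ennreal_mult[OF pos(2)[OF that] pos(1)[OF that]] mult.left_commute)
    also have "\<dots> = state_gf x 0 * ennreal (Q x / y x)"
      unfolding ennreal_suminf_cmult
      by (rule arg_cong[where f = "\<lambda>c. state_gf x 0 * c"])
        (rule suminf_ennreal_eq[OF mult_nonneg_nonneg[OF pos(2)[OF that] pos(1)[OF that]] ser(2)[OF that]])
    finally show ?thesis .
  qed
  have nnP: "0 \<le> P x / y x" and nnQ: "0 \<le> Q x / y x" if "x \<in> {-1, 1}" for x
    using sums_le[OF _ sums_zero ser(1)[OF that]] sums_le[OF _ sums_zero ser(2)[OF that]]
      pos[OF that] by simp_all
  have fin: "state_gf x 0 < top" if "x \<in> {-1, 1}" for x
  proof -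
    have "state_gf x 0 \<le> (\<Sum>n. state_gf x n)"
      using sum_le_suminf[of "state_gf x" "{0}"] by simp
    also have "\<dots> \<le> (\<Sum>n. state_gf 1 n) + (\<Sum>n. state_gf (-1) n)"
      using that by auto
    finally show ?thesis
      using state_gf_total_finite unfolding state_gf_total by (rule le_less_trans)
  qed
  then obtain A B where A: "state_gf 1 0 = ennreal A" "A \<ge> 0" and B: "state_gf (-1) 0 = ennreal B" "B \<ge> 0"
    unfolding less_top_ennreal by (metis insertI1 insertI2)
  define pm pp qm qp where r: "pm = P (-1) / y (-1)" "pp = P 1 / y 1" "qm = Q (-1) / y (-1)" "qp = Q 1 / y 1"
  have nn: "0 \<le> pm" "0 \<le> pp" "0 \<le> qm" "0 \<le> qp" "0 \<le> y 1" "0 \<le> y (-1)" "0 \<le> l"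
    unfolding r using nnP[of 1] nnP[of "-1"] nnQ[of 1] nnQ[of "-1"] y(1)[of 1] y(1)[of "-1"] l_pos
    by simp_all
  have "ennreal A = ennreal l + ennreal (y 1) * (ennreal B * ennreal qm)"
    using state_gf_switch[of 1] swi[of "-1"] A(1) B(1) by (simp add: y_def r)
  also have "\<dots> = ennreal (l + y 1 * (B * qm))"
    using nn B(2) by (simp add: ennreal_mult ennreal_plus)
  finally have eqA: "A = l + y 1 * (B * qm)"
    using A B nn by (subst (asm) ennreal_inj) auto
  have "ennreal B = ennreal (y (-1)) * (ennreal A * ennreal qp)"
    using state_gf_switch[of "-1"] swi[of 1] A(1) B(1) by (simp add: y_def r)
  also have "\<dots> = ennreal (y (-1) * (A * qp))"
    using nn A(2) by (simp add: ennreal_mult)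
  finally have eqB: "B = y (-1) * (A * qp)"
    using A B nn by (subst (asm) ennreal_inj) auto
  have "ennreal (1 - \<rho>) * (\<Sum>k. ennreal (\<rho> ^ k) * (\<integral>\<^sup>+\<omega>. ennreal (l powi walk X k \<omega>) \<partial>\<Omega>))
      = ennreal (1 - \<rho>) * (ennreal A * ennreal pp + ennreal B * ennreal pm)"
    unfolding state_gf_total using run[of 1] run[of "-1"] A(1) B(1) by (simp add: r)
  also have "\<dots> = ennreal ((1 - \<rho>) * (A * pp + B * pm))"
    using nn A(2) B(2) rho l_less by (simp add: ennreal_mult ennreal_plus)
  also have eqV: "(1 - \<rho>) * (A * pp + B * pm) = V"
  proof -
    have A': "A = l + l * \<rho> * (B * ((1 + P (-1) * (1 - 1 / (\<rho> / l))) / (\<rho> / l)))"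
      using eqA unfolding r Q_def y1 ym .
    have B': "B = \<rho> / l * (A * ((1 + P 1 * (1 - 1 / (l * \<rho>))) / (l * \<rho>)))"
      using eqB unfolding r Q_def y1 ym .
    have "P 1 = hat_P \<alpha> 2 (l * \<rho>)" "P (-1) = hat_P \<alpha> 1 (\<rho> / l)"
      by (simp_all add: P_def y1 ym letter_index_def)
    then show ?thesis
      using switching_system_solution[OF l_pos rho(1) A' B'] unfolding V Let_def r y1 ym by metis
  qed
  finally show "ennreal (1 - \<rho>) * (\<Sum>k. ennreal (\<rho> ^ k) * (\<integral>\<^sup>+\<omega>. ennreal (l powi walk X k \<omega>) \<partial>\<Omega>)) = ennreal V" .
  show "0 \<le> V"
    unfolding eqV[symmetric] using nn A(2) B(2) rho l_less by simp
qed

end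

section \<open>Evaluation at an independent time\<close>

text \<open>On \<open>\<tau> = k\<close> the integrand is a measurable function of the path of the chain, which is independent
of this event.\<close>

lemma nn_integral_independent_time:
  assumes indep: "indep_rv \<Omega> (count_space UNIV) \<tau>
           (\<Pi>\<^sub>M n\<in>UNIV. count_space state_space) (\<lambda>\<omega> n. (X n \<omega>, M n \<omega>))"
  shows "(\<integral>\<^sup>+\<omega>. ennreal (l powi walk X (\<tau> \<omega>) \<omega>) \<partial>\<Omega>)
    = (\<Sum>k. ennreal \<P>(\<omega> in \<Omega>. \<tau> \<omega> = k) * (\<integral>\<^sup>+\<omega>. ennreal (l powi walk X k \<omega>) \<partial>\<Omega>))"
proof -
  have tau [measurable]: "\<tau> \<in> measurable \<Omega> (count_space UNIV)"
    using indep by (simp add: indep_rv_def)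
  let ?S = "\<Pi>\<^sub>M n\<in>(UNIV :: nat set). count_space state_space"
  have g: "(\<lambda>z. ennreal (l powi (\<Sum>j=0..k. fst (z j)))) \<in> borel_measurable ?S" for k
  proof -
    have "(\<lambda>z. fst (z j)) \<in> measurable ?S (count_space UNIV)" for j
      by (rule measurable_compose[OF measurable_component_singleton]) auto
    then have "(\<lambda>z. l powi fst (z j)) \<in> borel_measurable ?S" for j
      by (rule measurable_compose) simp
    then have "(\<lambda>z. \<Prod>j=0..k. l powi fst (z j)) \<in> borel_measurable ?S"
      by (rule borel_measurable_prod)
    moreover have "(\<Prod>j=0..k. l powi fst (z j)) = l powi (\<Sum>j=0..k. fst (z j))" for z :: "nat \<Rightarrow> int \<times> nat"
      using l_pos by (induction k) (simp_all add: power_int_add)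
    ultimately show ?thesis
      by simp
  qed
  have meas: "(\<lambda>\<omega>. ennreal (l powi walk X (\<tau> \<omega>) \<omega>)) \<in> borel_measurable \<Omega>"
    by (rule measurable_compose_countable[OF _ tau]) simp
  have "(\<integral>\<^sup>+\<omega>. ennreal (l powi walk X (\<tau> \<omega>) \<omega>) \<partial>\<Omega>)
      = (\<Sum>k. \<integral>\<^sup>+\<omega>. ennreal (l powi walk X (\<tau> \<omega>) \<omega>) * indicator {\<omega>. \<tau> \<omega> = k} \<omega> \<partial>\<Omega>)"
    unfolding nn_integral_split_countable[OF tau _ meas, simplified] by (rule nn_integral_count_space_nat)
  also have "\<dots> = (\<Sum>k. ennreal \<P>(\<omega> in \<Omega>. \<tau> \<omega> = k) * (\<integral>\<^sup>+\<omega>. ennreal (l powi walk X k \<omega>) \<partial>\<Omega>))"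
  proof (rule suminf_cong)
    fix k
    have "(\<integral>\<^sup>+\<omega>. ennreal (l powi walk X (\<tau> \<omega>) \<omega>) * indicator {\<omega>. \<tau> \<omega> = k} \<omega> \<partial>\<Omega>)
        = (\<integral>\<^sup>+\<omega>. indicator {k} (\<tau> \<omega>) * ennreal (l powi (\<Sum>j=0..k. fst (X j \<omega>, M j \<omega>))) \<partial>\<Omega>)"
      by (intro nn_integral_cong) (auto simp: walk_def split: split_indicator)
    also have "\<dots> = emeasure \<Omega> (\<tau> -` {k} \<inter> space \<Omega>) * (\<integral>\<^sup>+\<omega>. ennreal (l powi (\<Sum>j=0..k. fst (X j \<omega>, M j \<omega>))) \<partial>\<Omega>)"
      by (rule indep_rv_nn_integral_indicator[OF prob_space_axioms indep _ g]) simp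
    also have "\<tau> -` {k} \<inter> space \<Omega> = {\<omega> \<in> space \<Omega>. \<tau> \<omega> = k}"
      by auto
    finally show "(\<integral>\<^sup>+\<omega>. ennreal (l powi walk X (\<tau> \<omega>) \<omega>) * indicator {\<omega>. \<tau> \<omega> = k} \<omega> \<partial>\<Omega>)
        = ennreal \<P>(\<omega> in \<Omega>. \<tau> \<omega> = k) * (\<integral>\<^sup>+\<omega>. ennreal (l powi walk X k \<omega>) \<partial>\<Omega>)"
      by (simp add: emeasure_eq_measure walk_def)
  qed
  finally show ?thesis .
qed

end

theorem theorem4p10:
  fixes \<Omega> :: "'w measure"
    and \<alpha> :: "nat \<Rightarrow> nat \<Rightarrow> real"
    and X :: "nat \<Rightarrow> 'w \<Rightarrow> int"
    and M :: "nat \<Rightarrow> 'w \<Rightarrow> nat"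
    and \<tau> :: "'w \<Rightarrow> nat"
    and \<rho> l :: real
  assumes "prob_space \<Omega>"
    and "\<And>i n. i \<in> {1, 2} \<Longrightarrow> n \<ge> 1 \<Longrightarrow> \<alpha> i n \<in> {0<..<1}"
    and "markov_chain \<Omega> state_space (trans_prob \<alpha>) (\<lambda>n \<omega>. (X n \<omega>, M n \<omega>))"
    and "AE \<omega> in \<Omega>. (X 0 \<omega>, M 0 \<omega>) = (1, 1)"
    and "0 < \<rho>" and "\<rho> < l" and "l < 1"
    and "indep_rv \<Omega> (count_space UNIV) \<tau>
           (\<Pi>\<^sub>M n\<in>UNIV. count_space state_space) (\<lambda>\<omega> n. (X n \<omega>, M n \<omega>))"
    and "\<And>k. \<P>(\<omega> in \<Omega>. \<tau> \<omega> = k) = \<rho> ^ k * (1 - \<rho>)"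
  shows "integrable \<Omega> (\<lambda>\<omega>. l powi walk X (\<tau> \<omega>) \<omega>) \<and>
    prob_space.expectation \<Omega> (\<lambda>\<omega>. l powi walk X (\<tau> \<omega>) \<omega>) =
      (let P1 = hat_P \<alpha> 1 (\<rho> / l); P2 = hat_P \<alpha> 2 (l * \<rho>) in
        ((\<rho> - 1) * (l * \<rho> * (P1 + P2) + (l * \<rho> - 1) * P1 * P2)) /
        (\<rho> * (l * \<rho> - 1) * P2 + l * \<rho> * (\<rho> - l) * P1
          + (l * \<rho> - 1) * (\<rho> - l) * P1 * P2))"
proof -
  have l: "0 < l"
    using assms(5,6) by simp
  interpret switching_walk \<Omega> \<alpha> X M l
    using assms(1-4) l by (intro switching_walk.intro switching_walk_axioms.intro) auto
  have tau: "\<tau> \<in> measurable \<Omega> (count_space UNIV)"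
    using assms(8) by (simp add: indep_rv_def)
  have meas: "(\<lambda>\<omega>. l powi walk X (\<tau> \<omega>) \<omega>) \<in> borel_measurable \<Omega>"
    by (rule measurable_compose_countable[OF _ tau]) simp
  let ?V = "let P1 = hat_P \<alpha> 1 (\<rho> / l); P2 = hat_P \<alpha> 2 (l * \<rho>) in
        ((\<rho> - 1) * (l * \<rho> * (P1 + P2) + (l * \<rho> - 1) * P1 * P2)) /
        (\<rho> * (l * \<rho> - 1) * P2 + l * \<rho> * (\<rho> - l) * P1
          + (l * \<rho> - 1) * (\<rho> - l) * P1 * P2)"
  have "(\<integral>\<^sup>+\<omega>. ennreal (l powi walk X (\<tau> \<omega>) \<omega>) \<partial>\<Omega>)
      = ennreal (1 - \<rho>) * (\<Sum>k. ennreal (\<rho> ^ k) * (\<integral>\<^sup>+\<omega>. ennreal (l powi walk X k \<omega>) \<partial>\<Omega>))"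
    unfolding nn_integral_independent_time[OF assms(8)] assms(9) ennreal_suminf_cmult[symmetric]
    using assms(5-7) by (intro suminf_cong) (simp add: ennreal_mult mult_ac)
  also have "\<dots> = ennreal ?V"
    by (rule generating_function(1)[OF assms(5-7) refl])
  finally have "has_bochner_integral \<Omega> (\<lambda>\<omega>. l powi walk X (\<tau> \<omega>) \<omega>) ?V"
    using meas l generating_function(2)[OF assms(5-7) refl]
    by (intro has_bochner_integral_nn_integral) auto
  then show ?thesis
    by (simp only: has_bochner_integral_iff)
qed

end
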